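(* Let $a\in\mathbb{C}$ and let $W\in\mathcal{O}_{\mathfrak{W}}$ be a highest weight module with highest weight vector $w_0$ of highest weight $b'\ne0$. Then $$\mathcal{L}_0(a,b')=\mathrm{span}\{d_1^i\cdot(w_0\otimes t^{2j}) : i\in\mathbb{Z}_+,\ j\in\mathbb{Z}\},$$ $$\mathcal{L}_1(a,b')=\mathrm{span}\{d_1^i\cdot(w_0\otimes t^{2j+1}) : i\in\mathbb{Z}_+,\ j\in\mathbb{Z}\}$$ are $\mathfrak{V}$-submodules of $\mathcal{L}(W,-1,a,b'+1)$, and $$\mathcal{L}(W,-1,a,b'+1)=\mathcal{L}_0(a,b')\oplus\mathcal{L}_1(a,b').$$
   Context: $\mathbb{Z}_+$ denotes the nonnegative integers. The Virasoro algebra $\mathfrak{V}$ has basis $\{d_n,z : n\in\mathbb{Z}\}$, $z$ central, $[d_n,d_m]=(m-n)d_{m+n}+\delta_{n,-m}\frac{n^3-n}{12}z$. $\mathfrak{W}=\mathrm{Der}(\mathbb{C}[t])$ has basis $\{d_i=t^{i+1}\frac{d}{dt} : i\ge-1\}$ with $[d_n,d_m]=(m-n)d_{m+n}$. $\mathcal{O}_{\mathfrak{W}}$ is the category of all $\mathfrak{W}$-modules $W$ such that for every $w\in W$ there is a nonnegative integer $n$ (depending on $w$) with $d_iw=0$ for all $i\ge n$. A highest weight $\mathfrak{W}$-module with highest weight vector $w_0$ of highest weight $b'$ is a $\mathfrak{W}$-module generated by a nonzero vector $w_0$ with $d_0w_0=b'w_0$ and $d_iw_0=0$ for all $i>0$.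 For $W\in\mathcal{O}_{\mathfrak{W}}$, $\lambda\in\mathbb{C}^*$, $a,b\in\mathbb{C}$, $\mathcal{L}(W,\lambda,a,b)=W\otimes\mathbb{C}[t,t^{-1}]$ is the $\mathfrak{V}$-module with $z\cdot(w\otimes t^j)=0$ and $d_k\cdot(w\otimes t^j)=\big(((\lambda^ke^{kt}-1)\frac{d}{dt}+a+kb+j)w\big)\otimes t^{k+j}$ for $k,j\in\mathbb{Z}$, $w\in W$, where $\frac{d}{dt}$ acts as $d_{-1}$ and $e^{kt}\frac{d}{dt}$ acts as $\sum_{i\ge0}\frac{k^i}{i!}d_{i-1}$. In the claim, $d_1^i\cdot$ denotes the $i$-fold action of $d_1\in\mathfrak{V}$ on $\mathcal{L}(W,-1,a,b'+1)$. *)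

theory Defs
  imports Complex_Main "HOL-Library.Poly_Mapping" "HOL-Computational_Algebra.Polynomial"
begin

section \<open>Lie algebras and their modules\<close>

locale lie_algebra = vector_space scale
  for scale :: "'k::field \<Rightarrow> 'l::ab_group_add \<Rightarrow> 'l" +
  fixes bracket :: "'l \<Rightarrow> 'l \<Rightarrow> 'l"
  assumes linear_bracket_left: "Vector_Spaces.linear scale scale (\<lambda>x. bracket x y)"
    and linear_bracket_right: "Vector_Spaces.linear scale scale (bracket x)"
    and bracket_self: "bracket x x = 0"
    and jacobi: "bracket x (bracket y u) + bracket y (bracket u x) + bracket u (bracket x y) = 0"

locale lie_module = L: lie_algebra scaleL bracket + V: vector_space scaleV
  for scaleL :: "'k::field \<Rightarrow> 'l::ab_group_add \<Rightarrow> 'l"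
    and bracket :: "'l \<Rightarrow> 'l \<Rightarrow> 'l"
    and scaleV :: "'k \<Rightarrow> 'v::ab_group_add \<Rightarrow> 'v" +
  fixes act :: "'l \<Rightarrow> 'v \<Rightarrow> 'v"
  assumes linear_act_left: "Vector_Spaces.linear scaleL scaleV (\<lambda>x. act x v)"
    and linear_act_right: "Vector_Spaces.linear scaleV scaleV (act x)"
    and act_bracket: "act (bracket x y) v = act x (act y v) - act y (act x v)"

definition lie_submodule ::
  "('k::field \<Rightarrow> 'l::ab_group_add \<Rightarrow> 'l) \<Rightarrow> ('l \<Rightarrow> 'l \<Rightarrow> 'l) \<Rightarrow>
   ('k \<Rightarrow> 'v::ab_group_add \<Rightarrow> 'v) \<Rightarrow> ('l \<Rightarrow> 'v \<Rightarrow> 'v) \<Rightarrow> 'v set \<Rightarrow> bool" where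
  "lie_submodule scaleL bracket scaleV act U \<longleftrightarrow>
     lie_module scaleL bracket scaleV act \<and> module.subspace scaleV U \<and>
     (\<forall>x. \<forall>u\<in>U. act x u \<in> U)"

definition is_internal_direct_sum :: "'v::ab_group_add set \<Rightarrow> 'v set \<Rightarrow> bool" where
  "is_internal_direct_sum A B \<longleftrightarrow> {x + y | x y. x \<in> A \<and> y \<in> B} = UNIV \<and> A \<inter> B = {0}"


section \<open>Finitely supported families\<close>

definition pm_scale :: "('k \<Rightarrow> 'v::zero \<Rightarrow> 'v) \<Rightarrow> 'k \<Rightarrow> ('i \<Rightarrow>\<^sub>0 'v) \<Rightarrow> ('i \<Rightarrow>\<^sub>0 'v)" where
  "pm_scale s c = Poly_Mapping.map (s c)"

text \<open>The extension to the direct sum of a family of linear maps on the summands.\<close>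

definition pm_ext :: "('i \<Rightarrow> 'v::zero \<Rightarrow> 'u::comm_monoid_add) \<Rightarrow> ('i \<Rightarrow>\<^sub>0 'v) \<Rightarrow> 'u" where
  "pm_ext g x = (\<Sum>k\<in>Poly_Mapping.keys x. g k (Poly_Mapping.lookup x k))"

lemma lookup_pm_scale:
  assumes "vector_space s"
  shows "Poly_Mapping.lookup (pm_scale s c x) k = s c (Poly_Mapping.lookup x k)"
proof -
  interpret vector_space s by fact
  show ?thesis
    by (simp add: pm_scale_def Poly_Mapping.map.rep_eq when_def)
qed

lemma pm_scale_single:
  assumes "vector_space s"
  shows "pm_scale s c (Poly_Mapping.single k v) = Poly_Mapping.single k (s c v)"
proof -
  interpret vector_space s by fact
  show ?thesis by (simp add: pm_scale_def)
qed

lemma vector_space_pm_scale: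
  assumes "vector_space s"
  shows "vector_space (pm_scale s)"
proof -
  interpret vector_space s by fact
  show ?thesis
    by unfold_locales
      (auto intro!: poly_mapping_eqI simp: lookup_pm_scale[OF assms] lookup_add
        scale_right_distrib scale_left_distrib)
qed

lemma pm_ext_single: "g k 0 = 0 \<Longrightarrow> pm_ext g (Poly_Mapping.single k v) = g k v"
  by (simp add: pm_ext_def)

lemma pm_ext_superset:
  assumes "\<And>k. g k 0 = 0" "finite A" "Poly_Mapping.keys x \<subseteq> A"
  shows "pm_ext g x = (\<Sum>k\<in>A. g k (Poly_Mapping.lookup x k))"
  unfolding pm_ext_def
  by (rule sum.mono_neutral_left) (use assms in \<open>auto simp: in_keys_iff\<close>)

lemma linear_pm_ext:
  fixes s :: "'k::field \<Rightarrow> 'v::ab_group_add \<Rightarrow> 'v" and s' :: "'k \<Rightarrow> 'u::ab_group_add \<Rightarrow> 'u"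
    and g :: "'i \<Rightarrow> 'v \<Rightarrow> 'u"
  assumes s: "vector_space s" and s': "vector_space s'" and g: "\<And>k. Vector_Spaces.linear s s' (g k)"
  shows "Vector_Spaces.linear (pm_scale s) s' (pm_ext g)"
proof -
  interpret s: vector_space s by fact
  interpret s': vector_space s' by fact
  interpret g: Vector_Spaces.linear s s' "g k" for k by (rule g)
  have g0: "g k 0 = 0" for k by (rule g.zero)
  show ?thesis
    unfolding Vector_Spaces.linear_iff
  proof (intro conjI allI vector_space_pm_scale s s')
    show "pm_ext g (x + y) = pm_ext g x + pm_ext g y" for x y
      unfolding pm_ext_def by (rule setsum_keys_plus_distrib) (simp_all add: g0 g.add)
    fix c and x :: "'i \<Rightarrow>\<^sub>0 'v"
    have sub: "Poly_Mapping.keys (pm_scale s c x) \<subseteq> Poly_Mapping.keys x"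
      by (auto simp: in_keys_iff lookup_pm_scale[OF s])
    have "pm_ext g (pm_scale s c x) =
        (\<Sum>k\<in>Poly_Mapping.keys x. g k (Poly_Mapping.lookup (pm_scale s c x) k))"
      by (rule pm_ext_superset) (use sub g0 in auto)
    also have "\<dots> = s' c (pm_ext g x)"
      by (simp add: lookup_pm_scale[OF s] g.scale pm_ext_def s'.scale_sum_right)
    finally show "pm_ext g (pm_scale s c x) = s' c (pm_ext g x)" .
  qed
qed

lemma linear_pm_ext_family:
  fixes s :: "'k::field \<Rightarrow> 'v::ab_group_add \<Rightarrow> 'v" and s' :: "'k \<Rightarrow> 'u::ab_group_add \<Rightarrow> 'u"
  assumes s: "vector_space s" and s': "vector_space s'" and g: "\<And>k c. Vector_Spaces.linear s s' (\<lambda>y. g y k c)"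
  shows "Vector_Spaces.linear s s' (\<lambda>y. pm_ext (g y) x)"
proof -
  interpret s': vector_space s' by fact
  interpret g: Vector_Spaces.linear s s' "\<lambda>y. g y k c" for k c by (rule g)
  show ?thesis
    unfolding Vector_Spaces.linear_iff pm_ext_def
    by (auto simp: s s' g.add g.scale sum.distrib s'.scale_sum_right)
qed

lemma vector_space_mult: "vector_space ((*) :: 'k::field \<Rightarrow> 'k \<Rightarrow> 'k)"
  by unfold_locales (auto simp: algebra_simps)

lemma additive_eqI:
  fixes f g :: "('i \<Rightarrow>\<^sub>0 'v::ab_group_add) \<Rightarrow> 'u::ab_group_add"
  assumes "\<And>x y. f (x + y) = f x + f y" "\<And>x y. g (x + y) = g x + g y"
    and "\<And>k v. f (Poly_Mapping.single k v) = g (Poly_Mapping.single k v)"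
  shows "f x = g x"
proof (induction x rule: update_induct)
  case const
  show ?case using assms(1)[of 0 0] assms(2)[of 0 0] by simp
next
  case (update h k v)
  then have "Poly_Mapping.update k v h = h + Poly_Mapping.single k v"
    by (intro poly_mapping_eqI) (auto simp: lookup_add lookup_update lookup_single in_keys_iff when_def)
  then show ?case by (simp add: assms update)
qed


section \<open>The Virasoro algebra\<close>

text \<open>The basis elements are \<open>Vd n\<close> and the central \<open>Vz\<close>; the Virasoro algebra is the
  free complex vector space on them.\<close>

datatype vir_basis = Vd int | Vz

type_synonym virasoro = "vir_basis \<Rightarrow>\<^sub>0 complex"

abbreviation vir_scale :: "complex \<Rightarrow> virasoro \<Rightarrow> virasoro" where
  "vir_scale \<equiv> pm_scale (*)"

abbreviation vir_d :: "int \<Rightarrow> virasoro" where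
  "vir_d n \<equiv> Poly_Mapping.single (Vd n) 1"

fun vir_bracket_basis :: "vir_basis \<Rightarrow> vir_basis \<Rightarrow> virasoro" where
  "vir_bracket_basis (Vd n) (Vd m) =
     Poly_Mapping.single (Vd (m + n)) (of_int (m - n)) +
     Poly_Mapping.single Vz (if n = - m then (of_int n ^ 3 - of_int n) / 12 else 0)"
| "vir_bracket_basis Vz q = 0"
| "vir_bracket_basis p Vz = 0"

definition vir_bracket :: "virasoro \<Rightarrow> virasoro \<Rightarrow> virasoro" where
  "vir_bracket x y =
     pm_ext (\<lambda>p c. pm_ext (\<lambda>q e. vir_scale (c * e) (vir_bracket_basis p q)) y) x"

interpretation vir: vector_space vir_scale
  by (intro vector_space_pm_scale vector_space_mult)

lemma vir_scale_single: "vir_scale c (Poly_Mapping.single k v) = Poly_Mapping.single k (c * v)"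
  by (rule pm_scale_single[OF vector_space_mult])

lemma linear_vir_bracket_right: "Vector_Spaces.linear vir_scale vir_scale (vir_bracket x)"
  unfolding vir_bracket_def
  by (intro linear_pm_ext_family linear_pm_ext vir.vector_space_axioms vector_space_mult)
    (auto simp: Vector_Spaces.linear_iff vector_space_mult vir.vector_space_axioms algebra_simps)

lemma linear_vir_bracket_left: "Vector_Spaces.linear vir_scale vir_scale (\<lambda>x. vir_bracket x y)"
  unfolding vir_bracket_def
  by (intro linear_pm_ext_family linear_pm_ext vir.vector_space_axioms vector_space_mult)
    (auto simp: Vector_Spaces.linear_iff vector_space_mult vir.vector_space_axioms algebra_simps)

interpretation vbr: Vector_Spaces.linear vir_scale vir_scale "vir_bracket x" for x
  by (rule linear_vir_bracket_right)

interpretation vbl: Vector_Spaces.linear vir_scale vir_scale "\<lambda>x. vir_bracket x y" for y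
  by (rule linear_vir_bracket_left)

lemma vir_bracket_single:
  "vir_bracket (Poly_Mapping.single p c) (Poly_Mapping.single q e) =
     vir_scale (c * e) (vir_bracket_basis p q)"
  by (simp add: vir_bracket_def pm_ext_single)

lemma vir_bracket_d_d:
  "vir_bracket (vir_d n) (vir_d m) =
     vir_scale (of_int (m - n)) (vir_d (m + n)) +
     vir_scale (if n = - m then (of_int n ^ 3 - of_int n) / 12 else 0) (Poly_Mapping.single Vz 1)"
  by (simp add: vir_bracket_single vir_scale_single)

lemma vir_bracket_basis_swap: "vir_bracket_basis p q = - vir_bracket_basis q p"
  by (cases p; cases q)
    (auto intro!: poly_mapping_eqI simp: lookup_add lookup_single when_def field_simps)

lemma vir_bracket_swap: "vir_bracket x y = - vir_bracket y x"
proof (rule additive_eqI[of "\<lambda>x. vir_bracket x y" "\<lambda>x. - vir_bracket y x"])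
  fix p c
  show "vir_bracket (Poly_Mapping.single p c) y = - vir_bracket y (Poly_Mapping.single p c)"
  proof (rule additive_eqI[of _ "\<lambda>y. - vir_bracket y (Poly_Mapping.single p c)"])
    fix q e
    show "vir_bracket (Poly_Mapping.single p c) (Poly_Mapping.single q e) =
        - vir_bracket (Poly_Mapping.single q e) (Poly_Mapping.single p c)"
      unfolding vir_bracket_single by (subst vir_bracket_basis_swap) (simp add: mult.commute)
  qed (simp_all add: vbr.add vbl.add)
qed (simp_all add: vbr.add vbl.add)

lemma vir_jacobi_basis:
  "vir_bracket (Poly_Mapping.single p c) (vir_bracket (Poly_Mapping.single q e) (Poly_Mapping.single r f)) +
   vir_bracket (Poly_Mapping.single q e) (vir_bracket (Poly_Mapping.single r f) (Poly_Mapping.single p c)) +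
   vir_bracket (Poly_Mapping.single r f) (vir_bracket (Poly_Mapping.single p c) (Poly_Mapping.single q e)) = 0"
proof (cases "\<exists>n m l. p = Vd n \<and> q = Vd m \<and> r = Vd l")
  case True
  then obtain n m l where [simp]: "p = Vd n" "q = Vd m" "r = Vd l" by blast
  have z: "vir_bracket (Poly_Mapping.single k v) (Poly_Mapping.single Vz u) = 0" for k v u
    by (cases k) (simp_all add: vir_bracket_single)
  have br: "vir_bracket (Poly_Mapping.single (Vd n) c) (Poly_Mapping.single (Vd m) e) =
      Poly_Mapping.single (Vd (m + n)) (c * e * of_int (m - n)) +
      Poly_Mapping.single Vz (c * e * (if n = - m then (of_int n ^ 3 - of_int n) / 12 else 0))"
    for n m c e
    by (simp add: vir_bracket_single vir.scale_right_distrib vir_scale_single)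
  have tr: "vir_bracket (Poly_Mapping.single (Vd n) c)
        (vir_bracket (Poly_Mapping.single (Vd m) e) (Poly_Mapping.single (Vd l) f)) =
      Poly_Mapping.single (Vd (n + m + l)) (c * e * f * (of_int (l - m) * of_int (l + m - n))) +
      Poly_Mapping.single Vz (c * e * f * (if n + m + l = 0
        then of_int (l - m) * (of_int n ^ 3 - of_int n) / 12 else 0))"
    for n m l c e f
  proof -
    have i: "l + m + n = n + m + l" and j: "n = - (l + m) \<longleftrightarrow> n + m + l = 0" by auto
    show ?thesis
      unfolding br[of m e] vbr.add z br i j by (simp add: mult.assoc mult.left_commute)
  qed
  have A: "c * e * f * (of_int (l - m) * of_int (l + m - n)) +
     e * f * c * (of_int (n - l) * of_int (n + l - m)) +
     f * c * e * (of_int (m - n) * of_int (m + n - l)) = (0::complex)"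
    by (simp add: algebra_simps)
  have B: "c * e * f * (if n + m + l = 0 then of_int (l - m) * (of_int n ^ 3 - of_int n) / 12 else 0) +
     e * f * c * (if n + m + l = 0 then of_int (n - l) * (of_int m ^ 3 - of_int m) / 12 else 0) +
     f * c * e * (if n + m + l = 0 then of_int (m - n) * (of_int l ^ 3 - of_int l) / 12 else 0) = (0::complex)"
  proof (cases "n + m + l = 0")
    case True
    then have l: "l = - n - m" by simp
    show ?thesis unfolding l by (simp add: field_simps power3_eq_cube)
  qed simp
  have idx: "m + l + n = n + m + l" "l + n + m = n + m + l" by simp_all
  have "vir_bracket (Poly_Mapping.single p c) (vir_bracket (Poly_Mapping.single q e) (Poly_Mapping.single r f)) +
   vir_bracket (Poly_Mapping.single q e) (vir_bracket (Poly_Mapping.single r f) (Poly_Mapping.single p c)) +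
   vir_bracket (Poly_Mapping.single r f) (vir_bracket (Poly_Mapping.single p c) (Poly_Mapping.single q e)) =
   Poly_Mapping.single (Vd (n + m + l)) (c * e * f * (of_int (l - m) * of_int (l + m - n)) +
     e * f * c * (of_int (n - l) * of_int (n + l - m)) +
     f * c * e * (of_int (m - n) * of_int (m + n - l))) +
   Poly_Mapping.single Vz (c * e * f * (if n + m + l = 0 then of_int (l - m) * (of_int n ^ 3 - of_int n) / 12 else 0) +
     e * f * c * (if n + m + l = 0 then of_int (n - l) * (of_int m ^ 3 - of_int m) / 12 else 0) +
     f * c * e * (if n + m + l = 0 then of_int (m - n) * (of_int l ^ 3 - of_int l) / 12 else 0))"
    unfolding \<open>p = _\<close> \<open>q = _\<close> \<open>r = _\<close> tr idx single_add by (simp only: add.assoc add.left_commute)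
  then show ?thesis unfolding A B by simp
next
  case False
  have z1: "vir_bracket x (Poly_Mapping.single Vz u) = 0" for x u
  proof (rule additive_eqI[of "\<lambda>x. vir_bracket x (Poly_Mapping.single Vz u)" "\<lambda>_. 0"])
    show "vir_bracket (Poly_Mapping.single k v) (Poly_Mapping.single Vz u) = 0" for k v
      by (cases k) (simp_all add: vir_bracket_single)
  qed (simp_all add: vbl.add)
  have z2: "vir_bracket (Poly_Mapping.single Vz u) x = 0" for x u
    by (subst vir_bracket_swap) (simp add: z1)
  from False have "p = Vz \<or> q = Vz \<or> r = Vz" by (metis vir_basis.exhaust)
  then show ?thesis by (auto simp: z1 z2)
qed

lemma vir_jacobi:
  "vir_bracket x (vir_bracket y u) + vir_bracket y (vir_bracket u x) + vir_bracket u (vir_bracket x y) = 0"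
proof -
  define J where "J x y u = vir_bracket x (vir_bracket y u) + vir_bracket y (vir_bracket u x) +
    vir_bracket u (vir_bracket x y)" for x y u
  have add: "J (x + x') y u = J x y u + J x' y u" "J x (y + y') u = J x y u + J x y' u"
    "J x y (u + u') = J x y u + J x y u'" for x x' y y' u u'
    unfolding J_def vbl.add vbr.add by (simp_all only: ac_simps)
  have J1: "J (Poly_Mapping.single p c) (Poly_Mapping.single q e) u = 0" for p c q e u
    by (rule additive_eqI[of "J (Poly_Mapping.single p c) (Poly_Mapping.single q e)" "\<lambda>_. 0"])
      (simp_all add: add, simp add: J_def vir_jacobi_basis)
  have J2: "J (Poly_Mapping.single p c) y u = 0" for p c y u
    by (rule additive_eqI[of "\<lambda>y. J (Poly_Mapping.single p c) y u" "\<lambda>_. 0"])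
      (simp_all add: add J1)
  have "J x y u = 0"
    by (rule additive_eqI[of "\<lambda>x. J x y u" "\<lambda>_. 0"]) (simp_all add: add J2)
  then show ?thesis by (simp add: J_def)
qed

lemma vir_bracket_self: "vir_bracket x x = 0"
proof (rule poly_mapping_eqI)
  fix k
  have "Poly_Mapping.lookup (vir_bracket x x) k = Poly_Mapping.lookup (- vir_bracket x x) k"
    by (rule arg_cong[OF vir_bracket_swap])
  then show "Poly_Mapping.lookup (vir_bracket x x) k = Poly_Mapping.lookup 0 k" by simp
qed

lemma lie_algebra_virasoro: "lie_algebra vir_scale vir_bracket"
  by (intro lie_algebra.intro lie_algebra_axioms.intro vir.vector_space_axioms
    linear_vir_bracket_left linear_vir_bracket_right vir_bracket_self vir_jacobi)


section \<open>The Lie algebra of derivations of the polynomial ring\<close>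

text \<open>The polynomial \<open>f\<close> stands for the derivation \<open>f d/dt\<close>.\<close>

definition der_bracket :: "complex poly \<Rightarrow> complex poly \<Rightarrow> complex poly" where
  "der_bracket f g = f * pderiv g - g * pderiv f"

text \<open>Only meaningful for \<open>i \<ge> -1\<close>.\<close>

definition der_d :: "int \<Rightarrow> complex poly" where
  "der_d i = monom 1 (nat (i + 1))"

lemma der_bracket_d_d:
  assumes "n \<ge> -1" "m \<ge> -1"
  shows "der_bracket (der_d n) (der_d m) = smult (of_int (m - n)) (der_d (m + n))"
proof -
  obtain a b where [simp]: "n = int a - 1" "m = int b - 1"
    using assms by (metis add.commute add_diff_cancel_left' add_uminus_conv_diff diff_ge_0_iff_ge nonneg_int_cases uminus_add_conv_diff)
  show ?thesis
  proof (cases "a + b = 0")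
    case True
    then show ?thesis by (simp add: der_bracket_def)
  next
    case False
    have "nat (int a + int b - 1) = a + b - 1" by simp
    with False show ?thesis
      by (cases a; cases b)
        (auto simp: der_bracket_def der_d_def pderiv_monom mult_monom smult_monom diff_monom minus_monom
          nat_add_distrib algebra_simps)
  qed
qed

lemma lie_algebra_der: "lie_algebra smult der_bracket"
proof -
  interpret vector_space "smult :: complex \<Rightarrow> _"
    by unfold_locales (auto simp: smult_add_right smult_add_left)
  show ?thesis
    by unfold_locales
      (auto simp: der_bracket_def pderiv_add pderiv_diff pderiv_smult pderiv_mult algebra_simps smult_diff_right)
qed

definition cat_O :: "(complex \<Rightarrow> 'w::ab_group_add \<Rightarrow> 'w) \<Rightarrow> (complex poly \<Rightarrow> 'w \<Rightarrow> 'w) \<Rightarrow> bool" where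
  "cat_O scale act \<longleftrightarrow> lie_module smult der_bracket scale act \<and>
     (\<forall>w. \<exists>n::nat. \<forall>i\<ge>int n. act (der_d i) w = 0)"

definition highest_weight_module ::
  "(complex \<Rightarrow> 'w::ab_group_add \<Rightarrow> 'w) \<Rightarrow> (complex poly \<Rightarrow> 'w \<Rightarrow> 'w) \<Rightarrow> 'w \<Rightarrow> complex \<Rightarrow> bool" where
  "highest_weight_module scale act w\<^sub>0 b' \<longleftrightarrow>
     lie_module smult der_bracket scale act \<and>
     w\<^sub>0 \<noteq> 0 \<and>
     (\<forall>U. lie_submodule smult der_bracket scale act U \<and> w\<^sub>0 \<in> U \<longrightarrow> U = UNIV) \<and>
     act (der_d 0) w\<^sub>0 = scale b' w\<^sub>0 \<and>
     (\<forall>i>0. act (der_d i) w\<^sub>0 = 0)"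


section \<open>The modules \<open>\<L>(W, \<lambda>, a, b)\<close>\<close>

text \<open>The action of \<open>exp(k t) d/dt\<close>. For modules in the category \<open>\<O>\<close> the family below is
  finitely supported, so that its \<^const>\<open>Sum_any\<close> is the intended sum.\<close>

definition exp_act ::
  "(complex \<Rightarrow> 'w::ab_group_add \<Rightarrow> 'w) \<Rightarrow> (complex poly \<Rightarrow> 'w \<Rightarrow> 'w) \<Rightarrow> int \<Rightarrow> 'w \<Rightarrow> 'w" where
  "exp_act scale act k w =
     Sum_any (\<lambda>i::nat. scale (of_int k ^ i / fact i) (act (der_d (int i - 1)) w))"

text \<open>The space \<open>W \<otimes> \<complex>[t, t\<^sup>-\<^sup>1]\<close> is \<open>int \<Rightarrow>\<^sub>0 'w\<close> with scalar multiplication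
  \<open>pm_scale scale\<close>, where \<open>w \<otimes> t\<^sup>j\<close> is \<open>Poly_Mapping.single j w\<close>.\<close>

abbreviation tensor_t :: "'w::zero \<Rightarrow> int \<Rightarrow> (int \<Rightarrow>\<^sub>0 'w)" where
  "tensor_t w j \<equiv> Poly_Mapping.single j w"

definition loop_d_op ::
  "(complex \<Rightarrow> 'w::ab_group_add \<Rightarrow> 'w) \<Rightarrow> (complex poly \<Rightarrow> 'w \<Rightarrow> 'w) \<Rightarrow>
   complex \<Rightarrow> complex \<Rightarrow> complex \<Rightarrow> int \<Rightarrow> int \<Rightarrow> 'w \<Rightarrow> 'w" where
  "loop_d_op scale act lam a b k j w =
     scale (lam powi k) (exp_act scale act k w) - act (der_d (-1)) w
       + scale (a + of_int k * b + of_int j) w"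

fun loop_basis_act ::
  "(complex \<Rightarrow> 'w::ab_group_add \<Rightarrow> 'w) \<Rightarrow> (complex poly \<Rightarrow> 'w \<Rightarrow> 'w) \<Rightarrow>
   complex \<Rightarrow> complex \<Rightarrow> complex \<Rightarrow> vir_basis \<Rightarrow> (int \<Rightarrow>\<^sub>0 'w) \<Rightarrow> (int \<Rightarrow>\<^sub>0 'w)" where
  "loop_basis_act scale act lam a b (Vd k) x =
     pm_ext (\<lambda>j w. tensor_t (loop_d_op scale act lam a b k j w) (k + j)) x"
| "loop_basis_act scale act lam a b Vz x = 0"

definition loop_act ::
  "(complex \<Rightarrow> 'w::ab_group_add \<Rightarrow> 'w) \<Rightarrow> (complex poly \<Rightarrow> 'w \<Rightarrow> 'w) \<Rightarrow>
   complex \<Rightarrow> complex \<Rightarrow> complex \<Rightarrow> virasoro \<Rightarrow> (int \<Rightarrow>\<^sub>0 'w) \<Rightarrow> (int \<Rightarrow>\<^sub>0 'w)" where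
  "loop_act scale act lam a b x v =
     pm_ext (\<lambda>p c. pm_scale scale c (loop_basis_act scale act lam a b p v)) x"

definition loop_L0 ::
  "(complex \<Rightarrow> 'w::ab_group_add \<Rightarrow> 'w) \<Rightarrow> (complex poly \<Rightarrow> 'w \<Rightarrow> 'w) \<Rightarrow> 'w \<Rightarrow>
   complex \<Rightarrow> complex \<Rightarrow> (int \<Rightarrow>\<^sub>0 'w) set" where
  "loop_L0 scale act w\<^sub>0 a b' = module.span (pm_scale scale)
     {(loop_act scale act (-1) a (b' + 1) (vir_d 1) ^^ i) (tensor_t w\<^sub>0 (2 * j)) | (i::nat) (j::int). True}"

definition loop_L1 ::
  "(complex \<Rightarrow> 'w::ab_group_add \<Rightarrow> 'w) \<Rightarrow> (complex poly \<Rightarrow> 'w \<Rightarrow> 'w) \<Rightarrow> 'w \<Rightarrow>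
   complex \<Rightarrow> complex \<Rightarrow> (int \<Rightarrow>\<^sub>0 'w) set" where
  "loop_L1 scale act w\<^sub>0 a b' = module.span (pm_scale scale)
     {(loop_act scale act (-1) a (b' + 1) (vir_d 1) ^^ i) (tensor_t w\<^sub>0 (2 * j + 1)) | (i::nat) (j::int). True}"

definition exp_poly :: "int \<Rightarrow> nat \<Rightarrow> complex poly" where
  "exp_poly k M = (\<Sum>i<M. monom (of_int k ^ i / fact i) i)"

lemma coeff_exp_poly: "coeff (exp_poly k M) i = (if i < M then of_int k ^ i / fact i else 0)"
  by (simp add: exp_poly_def coeff_sum if_distrib[of "\<lambda>x. x = _"] cong: if_cong)

lemma coeff_exp_poly_pderiv:
  assumes "i + 1 < M"
  shows "coeff (exp_poly k M * pderiv (exp_poly l M)) i = of_int l * (of_int (k + l) ^ i / fact i)"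
proof -
  have p: "coeff (pderiv (exp_poly l M)) m = of_int l * (of_int l ^ m / fact m)" if "m + 1 < M" for m
  proof -
    have "(1 + of_nat m :: complex) \<noteq> 0" by (metis of_nat_Suc of_nat_neq_0)
    then show ?thesis using that by (simp add: coeff_pderiv coeff_exp_poly)
  qed
  have "coeff (exp_poly k M * pderiv (exp_poly l M)) i =
      (\<Sum>j\<le>i. (of_int k ^ j / fact j) * (of_int l * (of_int l ^ (i - j) / fact (i - j))))"
    unfolding coeff_mult
    by (rule sum.cong) (use assms in \<open>auto simp: p coeff_exp_poly\<close>)
  also have "\<dots> = of_int l * (\<Sum>j\<le>i. (of_int k ^ j / fact j) * (of_int l ^ (i - j) / fact (i - j)))"
    by (simp add: sum_distrib_left mult_ac)
  also have "(\<Sum>j\<le>i. (of_int k ^ j / fact j) * (of_int l ^ (i - j) / fact (i - j))) =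
      (of_int (k + l) ^ i / fact i :: complex)"
    using exp_series_add_commuting[of "of_int k :: complex" "of_int l" i]
    by (simp add: scaleR_conv_of_real divide_inverse mult_ac)
  finally show ?thesis .
qed

context
  fixes scale :: "complex \<Rightarrow> 'w::ab_group_add \<Rightarrow> 'w" and act :: "complex poly \<Rightarrow> 'w \<Rightarrow> 'w"
  assumes O: "cat_O scale act"
begin

interpretation W: lie_module smult der_bracket scale act
  using O by (simp add: cat_O_def)

interpretation AR: Vector_Spaces.linear scale scale "act x" for x
  by (rule W.linear_act_right)

interpretation AL: Vector_Spaces.linear smult scale "\<lambda>x. act x w" for w
  by (rule W.linear_act_left)

lemma cat_O_bound:
  obtains n where "\<And>i. i \<ge> n \<Longrightarrow> act (monom 1 (Suc i)) w = 0"
proof -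
  from O obtain n where n: "\<And>i. i \<ge> int n \<Longrightarrow> act (der_d i) w = 0"
    unfolding cat_O_def by blast
  show thesis
  proof
    fix i assume "i \<ge> n"
    then show "act (monom 1 (Suc i)) w = 0"
      using n[of "int i"] by (simp add: der_d_def nat_add_distrib)
  qed
qed

lemma act_monom: "act (monom c i) w = scale c (act (monom 1 i) w)"
  using AL.scale[of c "monom 1 i" w] by (simp add: smult_monom)

lemma exp_act_finite:
  assumes "\<And>i. i \<ge> n \<Longrightarrow> act (monom 1 (Suc i)) w = 0" "n < M"
  shows "exp_act scale act k w = act (exp_poly k M) w"
proof -
  have z: "act (monom 1 i) w = 0" if "\<not> i < M" for i
    using assms(1)[of "i - 1"] assms(2) that by simp
  have "exp_act scale act k w = (\<Sum>i<M. scale (of_int k ^ i / fact i) (act (monom 1 i) w))"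
    unfolding exp_act_def
    by (subst Sum_any.expand_superset[of "{..<M}"]) (use z in \<open>auto simp: der_d_def\<close>)
  also have "\<dots> = act (exp_poly k M) w"
    by (simp add: exp_poly_def AL.sum act_monom[of "_ / _"])
  finally show ?thesis .
qed

lemma act_high_order:
  assumes "\<And>i. i \<ge> n \<Longrightarrow> act (monom 1 (Suc i)) w = 0" "\<And>i. i \<le> n \<Longrightarrow> coeff r i = 0"
  shows "act r w = 0"
proof -
  have "act r w = act (\<Sum>i\<le>degree r. monom (coeff r i) i) w"
    by (simp add: poly_as_sum_of_monoms)
  also have "\<dots> = (\<Sum>i\<le>degree r. scale (coeff r i) (act (monom 1 i) w))"
    by (simp add: AL.sum act_monom[of "coeff _ _"])
  also have "\<dots> = 0"
  proof (rule sum.neutral, rule ballI)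
    fix i
    show "scale (coeff r i) (act (monom 1 i) w) = 0"
      by (cases "i \<le> n") (use assms(1)[of "i - 1"] assms(2) in auto)
  qed
  finally show ?thesis .
qed

lemma exp_act_comm:
  "exp_act scale act k (exp_act scale act l w) - exp_act scale act l (exp_act scale act k w) =
     scale (of_int (l - k)) (exp_act scale act (k + l) w)"
proof -
  obtain n where n: "\<And>i. i \<ge> n \<Longrightarrow> act (monom 1 (Suc i)) w = 0"
    using cat_O_bound by blast
  obtain n1 where n1: "\<And>i. i \<ge> n1 \<Longrightarrow> act (monom 1 (Suc i)) (exp_act scale act k w) = 0"
    using cat_O_bound by blast
  obtain n2 where n2: "\<And>i. i \<ge> n2 \<Longrightarrow> act (monom 1 (Suc i)) (exp_act scale act l w) = 0"
    using cat_O_bound by blast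
  define M where "M = n + n1 + n2 + 2"
  have M: "n < M" "n1 < M" "n2 < M" by (auto simp: M_def)
  note e = exp_act_finite[OF n M(1)]
  have "exp_act scale act k (exp_act scale act l w) - exp_act scale act l (exp_act scale act k w) =
      act (exp_poly k M) (act (exp_poly l M) w) - act (exp_poly l M) (act (exp_poly k M) w)"
    by (simp only: exp_act_finite[OF n1 M(2)] exp_act_finite[OF n2 M(3)], simp only: e)
  also have "\<dots> = act (der_bracket (exp_poly k M) (exp_poly l M)) w"
    by (simp add: W.act_bracket)
  also have "\<dots> = act (smult (of_int (l - k)) (exp_poly (k + l) M)) w"
  proof -
    have "act (der_bracket (exp_poly k M) (exp_poly l M) - smult (of_int (l - k)) (exp_poly (k + l) M)) w = 0"
    proof (rule act_high_order[OF n])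
      fix i assume "i \<le> n"
      then have i: "i + 1 < M" by (simp add: M_def)
      show "coeff (der_bracket (exp_poly k M) (exp_poly l M) - smult (of_int (l - k)) (exp_poly (k + l) M)) i = 0"
        using i unfolding der_bracket_def coeff_diff coeff_smult coeff_exp_poly_pderiv[OF i] coeff_exp_poly
        by (simp add: add.commute left_diff_distrib diff_divide_distrib)
    qed
    then show ?thesis by (simp add: AL.diff)
  qed
  also have "\<dots> = scale (of_int (l - k)) (exp_act scale act (k + l) w)"
    by (simp add: AL.scale e)
  finally show ?thesis .
qed

lemma exp_act_0: "exp_act scale act 0 w = act (der_d (-1)) w"
proof -
  obtain n where n: "\<And>i. i \<ge> n \<Longrightarrow> act (monom 1 (Suc i)) w = 0"
    using cat_O_bound by blast
  have "exp_poly 0 (Suc n) = monom 1 0"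
    by (rule poly_eqI) (auto simp: coeff_exp_poly power_0_left)
  then show ?thesis
    using exp_act_finite[where n = n and M = "Suc n" and k = 0, OF n] by (simp add: der_d_def)
qed

lemma linear_exp_act: "Vector_Spaces.linear scale scale (exp_act scale act k)"
  unfolding Vector_Spaces.linear_iff
proof (intro conjI allI W.V.vector_space_axioms)
  fix x y c
  obtain n where n: "\<And>i. i \<ge> n \<Longrightarrow> act (monom 1 (Suc i)) x = 0"
    using cat_O_bound by blast
  obtain m where m: "\<And>i. i \<ge> m \<Longrightarrow> act (monom 1 (Suc i)) y = 0"
    using cat_O_bound by blast
  define M where "M = Suc (n + m)"
  have "exp_act scale act k x = act (exp_poly k M) x"
    by (rule exp_act_finite[of n]) (auto simp: M_def n)
  moreover have "exp_act scale act k y = act (exp_poly k M) y"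
    by (rule exp_act_finite[of m]) (auto simp: M_def m)
  moreover have "exp_act scale act k (x + y) = act (exp_poly k M) (x + y)"
    by (rule exp_act_finite[of "n + m"]) (auto simp: M_def AR.add n m)
  moreover have "exp_act scale act k (scale c x) = act (exp_poly k M) (scale c x)"
    by (rule exp_act_finite[of "n + m"]) (auto simp: M_def AR.scale n m)
  ultimately show "exp_act scale act k (x + y) = exp_act scale act k x + exp_act scale act k y"
    "exp_act scale act k (scale c x) = scale c (exp_act scale act k x)"
    by (simp_all add: AR.add AR.scale)
qed

interpretation E: Vector_Spaces.linear scale scale "exp_act scale act k" for k
  by (rule linear_exp_act)

lemma linear_loop_d_op: "Vector_Spaces.linear scale scale (loop_d_op scale act lam a b k j)"
  unfolding Vector_Spaces.linear_iff loop_d_op_def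
  by (auto simp: W.V.vector_space_axioms E.add AR.add E.scale AR.scale W.V.scale_right_distrib
      W.V.scale_left_distrib W.V.scale_right_diff_distrib algebra_simps)

interpretation T: Vector_Spaces.linear scale scale "loop_d_op scale act lam a b k j" for lam a b k j
  by (rule linear_loop_d_op)

lemma loop_d_op_comm:
  assumes "lam \<noteq> 0"
  shows "loop_d_op scale act lam a b k (l + j) (loop_d_op scale act lam a b l j w) -
      loop_d_op scale act lam a b l (k + j) (loop_d_op scale act lam a b k j w) =
    scale (of_int (l - k)) (loop_d_op scale act lam a b (k + l) j w)"
proof -
  define P Q where "P = lam powi k" and "Q = lam powi l"
  have PQ: "lam powi (k + l) = P * Q"
    using assms by (simp add: P_def Q_def power_int_add)
  define D where "D = act (der_d (-1))"
  let ?E = "exp_act scale act"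
  have kl: "?E k (?E l w) = ?E l (?E k w) + scale (of_int l - of_int k) (?E (k + l) w)"
    using exp_act_comm[of k l w] by (simp add: algebra_simps)
  have kD: "?E k (D w) = D (?E k w) - scale (of_int k) (?E k w)" for k
    using exp_act_comm[of k 0 w] unfolding exp_act_0 D_def by (simp add: algebra_simps)
  note [simp] = W.V.scale_right_distrib W.V.scale_left_distrib W.V.scale_right_diff_distrib
      W.V.scale_left_diff_distrib
  show ?thesis
    unfolding loop_d_op_def PQ P_def[symmetric] Q_def[symmetric] D_def[symmetric]
    by (simp add: E.add E.scale E.diff AR.add[of "der_d (-1)", folded D_def]
        AR.scale[of "der_d (-1)", folded D_def] AR.diff[of "der_d (-1)", folded D_def] kl kD algebra_simps)
qed

interpretation TW: vector_space "pm_scale scale :: _ \<Rightarrow> (int \<Rightarrow>\<^sub>0 'w) \<Rightarrow> _"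
  by (intro vector_space_pm_scale W.V.vector_space_axioms)

lemma linear_loop_basis_act:
  "Vector_Spaces.linear (pm_scale scale) (pm_scale scale) (loop_basis_act scale act lam a b p)"
proof (cases p)
  case (Vd k)
  have "loop_basis_act scale act lam a b p =
      pm_ext (\<lambda>j w. tensor_t (loop_d_op scale act lam a b k j w) (k + j))"
    by (rule ext) (simp add: Vd)
  moreover have "Vector_Spaces.linear (pm_scale scale) (pm_scale scale) \<dots>"
    by (intro linear_pm_ext W.V.vector_space_axioms TW.vector_space_axioms)
      (auto simp: Vector_Spaces.linear_iff W.V.vector_space_axioms TW.vector_space_axioms T.add T.scale
        single_add pm_scale_single)
  ultimately show ?thesis by simp
next
  case Vz
  then show ?thesis by (simp add: Vector_Spaces.linear_iff TW.vector_space_axioms)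
qed

interpretation BA: Vector_Spaces.linear "pm_scale scale" "pm_scale scale" "loop_basis_act scale act lam a b p"
  for lam a b p by (rule linear_loop_basis_act)

lemma linear_loop_act_left:
  "Vector_Spaces.linear vir_scale (pm_scale scale) (\<lambda>x. loop_act scale act lam a b x v)"
  unfolding loop_act_def
  by (intro linear_pm_ext vector_space_mult TW.vector_space_axioms)
    (auto simp: Vector_Spaces.linear_iff vector_space_mult TW.vector_space_axioms TW.scale_left_distrib)

lemma linear_loop_act_right:
  "Vector_Spaces.linear (pm_scale scale) (pm_scale scale) (loop_act scale act lam a b x)"
  unfolding loop_act_def
  by (intro linear_pm_ext_family TW.vector_space_axioms)
    (auto simp: Vector_Spaces.linear_iff TW.vector_space_axioms BA.add BA.scale
      TW.scale_right_distrib mult.commute)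

interpretation LL: Vector_Spaces.linear vir_scale "pm_scale scale" "\<lambda>x. loop_act scale act lam a b x v"
  for lam a b v by (rule linear_loop_act_left)

interpretation LR: Vector_Spaces.linear "pm_scale scale" "pm_scale scale" "loop_act scale act lam a b x"
  for lam a b x by (rule linear_loop_act_right)

lemma loop_act_single_Vz: "loop_act scale act lam a b (Poly_Mapping.single Vz c) v = 0"
  by (simp add: loop_act_def pm_ext_single)

lemma loop_act_single_Vd:
  "loop_act scale act lam a b (Poly_Mapping.single (Vd k) c) (tensor_t w j) =
     tensor_t (scale c (loop_d_op scale act lam a b k j w)) (k + j)"
  by (simp add: loop_act_def pm_ext_single T.zero pm_scale_single W.V.vector_space_axioms)

lemma loop_act_bracket:
  assumes "lam \<noteq> 0"
  shows "loop_act scale act lam a b (vir_bracket x y) v =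
    loop_act scale act lam a b x (loop_act scale act lam a b y v) -
    loop_act scale act lam a b y (loop_act scale act lam a b x v)"
proof -
  let ?A = "loop_act scale act lam a b"
  define J where "J x y v = ?A (vir_bracket x y) v - (?A x (?A y v) - ?A y (?A x v))" for x y v
  have add: "J (x + x') y v = J x y v + J x' y v" "J x (y + y') v = J x y v + J x y' v"
    "J x y (v + v') = J x y v + J x y v'" for x x' y y' v v'
    unfolding J_def vbl.add vbr.add LL.add LR.add by (simp_all add: algebra_simps)
  have J0: "J (Poly_Mapping.single p c) (Poly_Mapping.single q e) (tensor_t w j) = 0" for p c q e w j
  proof (cases "\<exists>n m. p = Vd n \<and> q = Vd m")
    case True
    then obtain n m where [simp]: "p = Vd n" "q = Vd m" by blast
    let ?T = "loop_d_op scale act lam a b"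
    have "?A (vir_bracket (Poly_Mapping.single p c) (Poly_Mapping.single q e)) (tensor_t w j) =
        tensor_t (scale (c * e) (scale (of_int (m - n)) (?T (n + m) j w))) (n + m + j)"
      by (simp add: vir_bracket_single vir.scale_right_distrib vir_scale_single LL.add
          loop_act_single_Vz loop_act_single_Vd add.commute)
    also have "\<dots> = ?A (Poly_Mapping.single p c) (?A (Poly_Mapping.single q e) (tensor_t w j)) -
        ?A (Poly_Mapping.single q e) (?A (Poly_Mapping.single p c) (tensor_t w j))"
      unfolding loop_d_op_comm[OF assms, symmetric]
      by (simp add: loop_act_single_Vd T.scale W.V.scale_right_diff_distrib single_diff ac_simps)
    finally show ?thesis by (simp add: J_def)
  next
    case False
    then have "p = Vz \<or> q = Vz" by (metis vir_basis.exhaust)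
    moreover have "vir_bracket_basis p Vz = 0" "vir_bracket_basis Vz q = 0"
      by (cases p; simp)+
    ultimately show ?thesis
      by (auto simp: J_def vir_bracket_single loop_act_single_Vz LL.zero LR.zero)
  qed
  have J1: "J (Poly_Mapping.single p c) (Poly_Mapping.single q e) v = 0" for p c q e v
    by (rule additive_eqI[of "J (Poly_Mapping.single p c) (Poly_Mapping.single q e)" "\<lambda>_. 0"])
      (simp_all add: add J0)
  have J2: "J (Poly_Mapping.single p c) y v = 0" for p c y v
    by (rule additive_eqI[of "\<lambda>y. J (Poly_Mapping.single p c) y v" "\<lambda>_. 0"])
      (simp_all add: add J1)
  have "J x y v = 0"
    by (rule additive_eqI[of "\<lambda>x. J x y v" "\<lambda>_. 0"]) (simp_all add: add J2)
  then show ?thesis by (simp add: J_def)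
qed

lemma lie_module_loop_act:
  assumes "lam \<noteq> 0"
  shows "lie_module vir_scale vir_bracket (pm_scale scale) (loop_act scale act lam a b)"
  by (intro lie_module.intro lie_module_axioms.intro lie_algebra_virasoro TW.vector_space_axioms
    linear_loop_act_left linear_loop_act_right loop_act_bracket assms)

lemma loop_act_d_tensor_t:
  "loop_act scale act lam a b (vir_d k) (tensor_t w j) =
    tensor_t (loop_d_op scale act lam a b k j w) (k + j)"
  by (simp add: loop_act_single_Vd)

end

end

theory Submission
  imports Defs
begin

text \<open>
  Write \<open>D\<close> for the action of \<open>d\<^sub>-\<^sub>1\<close> on \<open>W\<close>. Since \<open>w\<^sub>0\<close> is a highest weight vector of nonzero weight,
  the map \<open>p \<mapsto> p(D) w\<^sub>0\<close> is a bijection from \<open>\<complex>[x]\<close> to \<open>W\<close> (\<open>surj_at_D\<close>, \<open>inj_at_D\<close>). It carries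
  \<open>e\<^sup>k\<^sup>t d/dt\<close> to the difference operator \<open>p(x) \<mapsto> (x + k b') p(x - k)\<close> (\<open>exp_act_at_D\<close>), so that
  \<open>\<L>(W, -1, a, b' + 1)\<close> becomes \<open>\<complex>[x] \<otimes> \<complex>[t, t\<^sup>-\<^sup>1]\<close> with
  \<open>d\<^sub>k (p t\<^sup>j) = ((-1)\<^sup>k (x + k b') p(x - k) + (a + k (b' + 1) + j - x) p(x)) t\<^sup>k\<^sup>+\<^sup>j\<close>.

  In these coordinates the module has a symmetry: the involution
  \<open>p(x) t\<^sup>j \<mapsto> (-1)\<^sup>j p(a + j - x) t\<^sup>j\<close> exchanges the two summands of the formula above and hence
  commutes with every \<open>d\<^sub>k\<close> (\<open>reflect_loop_poly\<close>, \<open>swap_vact\<close>). Informally, the elements of the loop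
  module are distributions in two variables supported on the antidiagonal \<open>y = -x\<close>, and the
  involution exchanges the two variables; the parameters \<open>\<lambda> = -1\<close> and \<open>b = b' + 1\<close> are the ones for
  which both variables carry the same density weight.

  The involution multiplies \<open>w\<^sub>0 \<otimes> t\<^sup>j\<close> by \<open>(-1)\<^sup>j\<close>, so \<open>\<L>\<^sub>0\<close> lies in its \<open>+1\<close> eigenspace and \<open>\<L>\<^sub>1\<close> in
  its \<open>-1\<close> eigenspace; in particular they meet in \<open>0\<close>. They also span the whole module: \<open>d\<^sub>1\<close> raises
  the degree in \<open>x\<close> by exactly one, because the leading terms of its two summands add up instead of
  cancelling (\<open>degree_loop_poly_1\<close>). Hence for fixed \<open>m\<close> the vectors \<open>d\<^sub>1\<^sup>n (w\<^sub>0 \<otimes> t\<^sup>m\<^sup>-\<^sup>n)\<close> contain one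
  polynomial of each degree \<open>n\<close> times \<open>t\<^sup>m\<close> (\<open>tensor_in_L_sum\<close>). Consequently \<open>\<L>\<^sub>0\<close> and \<open>\<L>\<^sub>1\<close> are equal to
  the two eigenspaces (\<open>L0_eq\<close>, \<open>L1_eq\<close>), and the eigenspaces of an operator commuting with the
  action are submodules.
\<close>

section \<open>Highest weight modules as polynomial spaces\<close>

locale highest_weight_O =
  fixes scale :: "complex \<Rightarrow> 'w::ab_group_add \<Rightarrow> 'w"
    and act :: "complex poly \<Rightarrow> 'w \<Rightarrow> 'w"
    and w0 :: 'w and b' :: complex
  assumes O: "cat_O scale act"
    and hw: "highest_weight_module scale act w0 b'"
begin

sublocale W: lie_module smult der_bracket scale act
  using O by (simp add: cat_O_def)

sublocale AR: Vector_Spaces.linear scale scale "act f" for f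
  by (rule W.linear_act_right)

sublocale AL: Vector_Spaces.linear smult scale "\<lambda>f. act f w" for w
  by (rule W.linear_act_left)

sublocale E: Vector_Spaces.linear scale scale "exp_act scale act k" for k
  by (rule linear_exp_act[OF O])

sublocale T: Vector_Spaces.linear scale scale "loop_d_op scale act lam a b k j" for lam a b k j
  by (rule linear_loop_d_op[OF O])

abbreviation D :: "'w \<Rightarrow> 'w" where "D \<equiv> act 1"

lemma der_d_minus_one: "der_d (-1) = 1"
  by (simp add: der_d_def)

text \<open>Bracketing a vector field with \<open>d\<^sub>-\<^sub>1 = d/dt\<close> differentiates its coefficient up to sign, so moving \<open>D\<close> to
  the left past \<open>f d/dt\<close> costs one derivative of \<open>f\<close>. Together with the values on \<open>w\<^sub>0\<close> this
  determines the action on every \<open>p(D) w\<^sub>0\<close>. As both equations match the term \<open>D\<close> on their own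
  right-hand sides, they are rewrite rules only for a fixed \<open>f\<close>.\<close>

lemma act_D: "act f (D u) = D (act f u) - act (pderiv f) u"
  using W.act_bracket[of f 1 u] AL.diff[of 0 "pderiv f" u]
  by (simp add: der_bracket_def AL.neg algebra_simps)

lemma act_w0: "act f w0 = scale (coeff f 0) (D w0) + scale (coeff f 1 * b') w0"
proof -
  define r where "r = f - monom (coeff f 0) 0 - monom (coeff f 1) 1"
  have high: "act (monom 1 (Suc i)) w0 = 0" if "i \<ge> 1" for i
    using hw that unfolding highest_weight_module_def der_d_def
    by (auto dest!: spec[of _ "int i"] simp: nat_add_distrib)
  have "act r w0 = 0"
  proof (rule act_high_order[OF O])
    show "act (monom 1 (Suc i)) w0 = 0" if "i \<ge> 1" for i
      using high that .
    show "coeff r i = 0" if "i \<le> 1" for i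
      using that by (cases i) (auto simp: r_def)
  qed
  moreover have "act (monom 1 1) w0 = scale b' w0"
    using hw by (simp add: highest_weight_module_def der_d_def)
  moreover have "act (monom (coeff f 0) 0) w0 = scale (coeff f 0) (D w0)"
    using act_monom[OF O, of "coeff f 0" 0 w0] by simp
  ultimately show ?thesis
    by (simp add: r_def AL.diff act_monom[OF O, of "coeff f (Suc 0)"] algebra_simps AL.add)
qed

text \<open>The vector \<open>p(D) w\<^sub>0\<close>, by Horner's scheme.\<close>

definition at_D :: "complex poly \<Rightarrow> 'w" where
  "at_D p = fold_coeffs (\<lambda>c v. scale c w0 + D v) p 0"

lemma at_D_0 [simp]: "at_D 0 = 0"
  by (simp add: at_D_def)

lemma at_D_pCons: "at_D (pCons c p) = scale c w0 + D (at_D p)"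
  by (cases "c = 0 \<and> p = 0") (auto simp: at_D_def AR.zero)

lemma at_D_1 [simp]: "at_D 1 = w0"
  by (simp add: one_pCons at_D_pCons AR.zero)

lemma at_D_add: "at_D (p + q) = at_D p + at_D q"
  by (induction p q rule: poly_induct2)
    (simp_all add: at_D_pCons W.V.scale_left_distrib AR.add algebra_simps)

lemma at_D_smult: "at_D (smult c p) = scale c (at_D p)"
  by (induction p)
    (simp_all add: at_D_pCons W.V.scale_right_distrib AR.scale)

lemma at_D_shift: "at_D (pCons 0 p) = D (at_D p)"
  by (simp add: at_D_pCons)

sublocale at_D: Vector_Spaces.linear smult scale at_D
  by (simp add: Vector_Spaces.linear_iff W.L.vector_space_axioms W.V.vector_space_axioms
      at_D_add at_D_smult)

text \<open>The vectors \<open>p(D) w\<^sub>0\<close> form a submodule, by moving \<open>D\<close> to the left in every product, and this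
  submodule contains the generator \<open>w\<^sub>0\<close>.\<close>

lemma surj_at_D: "surj at_D"
proof -
  have D_range: "D (at_D p) \<in> range at_D" for p
    by (metis at_D_shift rangeI)
  have sub: "W.V.subspace (range at_D)"
    using at_D.subspace_image[of UNIV] by simp
  have inv: "act f (at_D p) \<in> range at_D" for f p
  proof (induction p arbitrary: f)
    case 0
    then show ?case
      using rangeI[of at_D 0] by (simp add: AR.zero)
  next
    case (pCons c p)
    have w0: "w0 \<in> range at_D"
      by (metis at_D_1 rangeI)
    have Dw0: "D w0 \<in> range at_D"
      using D_range[of 1] by simp
    have "D (act f (at_D p)) \<in> range at_D"
      using pCons.IH[of f] D_range by auto
    then show ?case
      unfolding at_D_pCons AR.add AR.scale act_D[of f] act_w0[of f]
      by (intro W.V.subspace_add W.V.subspace_diff W.V.subspace_scale sub w0 Dw0 pCons.IH)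
  qed
  have "lie_submodule smult der_bracket scale act (range at_D)"
    unfolding lie_submodule_def using W.lie_module_axioms sub inv by auto
  moreover have "w0 \<in> range at_D"
    by (metis at_D_1 rangeI)
  ultimately show ?thesis
    using hw by (simp add: highest_weight_module_def)
qed

text \<open>A vector field vanishing to order \<open>n + 1\<close> loses one order with each of the \<open>n\<close> factors \<open>D\<close> that it
  passes, so only the term in which all of them differentiate it reaches \<open>w\<^sub>0\<close> with
  a \<open>d\<^sub>0\<close> component. The result is a multiple of \<open>b'\<close>: this is where a nonzero weight
  makes the vectors \<open>D\<^sup>n w\<^sub>0\<close> linearly independent.\<close>

lemma act_high_order_at_D:
  assumes "degree p \<le> n" "\<And>i. i \<le> n \<Longrightarrow> coeff f i = 0"
  shows "act f (at_D p) = scale ((-1) ^ n * fact (Suc n) * coeff f (Suc n) * coeff p n * b') w0"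
  using assms
proof (induction p arbitrary: f n)
  case 0
  then show ?case by (simp add: AR.zero)
next
  case (pCons c p)
  show ?case
  proof (cases n)
    case 0
    with pCons.prems(1) have "p = 0"
      by (metis degree_pCons_eq le_zero_eq nat.distinct(1))
    with 0 pCons.prems(2)[of 0] show ?thesis
      by (simp add: at_D_pCons AR.add AR.scale AR.zero act_w0[of f] mult_ac)
  next
    case (Suc m)
    have deg: "degree p \<le> m"
      using pCons.prems(1) Suc by (cases "p = 0") auto
    have "act f (at_D p) = 0"
      using pCons.IH[of m f] deg pCons.prems(2) Suc by simp
    moreover have "act f w0 = 0"
      using pCons.prems(2)[of 0] pCons.prems(2)[of 1] Suc by (simp add: act_w0[of f])
    moreover have "act (pderiv f) (at_D p) =
        scale ((-1) ^ m * fact (Suc m) * coeff (pderiv f) (Suc m) * coeff p m * b') w0"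
      by (rule pCons.IH) (use deg pCons.prems(2) Suc in \<open>auto simp: coeff_pderiv\<close>)
    ultimately have "act f (at_D (pCons c p)) =
        scale (- ((-1) ^ m * fact (Suc m) * coeff (pderiv f) (Suc m) * coeff p m * b')) w0"
      by (simp add: at_D_pCons AR.add AR.scale AR.zero act_D[of f])
    also have "- ((-1) ^ m * fact (Suc m) * coeff (pderiv f) (Suc m) * coeff p m * b') =
        (-1) ^ n * fact (Suc n) * coeff f (Suc n) * coeff (pCons c p) n * b'"
      by (simp add: Suc coeff_pderiv algebra_simps)
    finally show ?thesis .
  qed
qed

lemma inj_at_D:
  assumes "b' \<noteq> 0"
  shows "inj at_D"
  unfolding at_D.inj_iff_eq_0
proof (intro allI impI)
  fix p assume p: "at_D p = 0"
  let ?n = "degree p"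
  have "act (monom 1 (Suc ?n)) (at_D p) =
      scale ((-1) ^ ?n * fact (Suc ?n) * lead_coeff p * b') w0"
    by (subst act_high_order_at_D[of _ ?n]) auto
  then have "(-1) ^ ?n * fact (Suc ?n) * lead_coeff p * b' = 0"
    using p hw by (simp add: AR.zero highest_weight_module_def del: fact_Suc)
  then show "p = 0"
    using assms by (simp del: fact_Suc)
qed

text \<open>The relation \<open>e\<^sup>k\<^sup>t d/dt \<circ> D = (D - k) \<circ> e\<^sup>k\<^sup>t d/dt\<close> turns \<open>p(x)\<close> into \<open>p(x - k)\<close>, and
  \<open>e\<^sup>k\<^sup>t d/dt\<close> sends \<open>w\<^sub>0\<close> to \<open>d\<^sub>-\<^sub>1 w\<^sub>0 + k d\<^sub>0 w\<^sub>0 = (D + k b') w\<^sub>0\<close>.\<close>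

lemma exp_act_at_D:
  "exp_act scale act k (at_D p) =
     at_D ([:of_int k * b', 1:] * (p \<circ>\<^sub>p [:- of_int k, 1:]))"
proof (induction p)
  case 0
  then show ?case by (simp add: E.zero)
next
  case (pCons c p)
  \<comment> \<open>\<open>D\<close> is itself the operator of \<open>e\<^sup>0 d/dt\<close>.\<close>
  have comm: "exp_act scale act k (D u) =
      D (exp_act scale act k u) - scale (of_int k) (exp_act scale act k u)" for u
    using exp_act_comm[OF O, of k 0 u]
    unfolding exp_act_0[OF O] der_d_minus_one by (simp add: W.V.scale_minus_left algebra_simps)
  \<comment> \<open>The terms of the exponential series beyond the linear one kill \<open>w\<^sub>0\<close>.\<close>
  have "exp_act scale act k w0 = act (exp_poly k 2) w0"
  proof (rule exp_act_finite[OF O, of 1])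
    show "act (monom 1 (Suc i)) w0 = 0" if "1 \<le> i" for i
      using that by (simp add: act_w0[of "monom 1 (Suc i)"])
  qed simp
  then have w0: "exp_act scale act k w0 = at_D [:of_int k * b', 1:]"
    by (simp add: act_w0[of "exp_poly k 2"] coeff_exp_poly at_D_pCons AR.zero)
  let ?q = "[:of_int k * b', 1:] * (p \<circ>\<^sub>p [:- of_int k, 1:])"
  have "exp_act scale act k (at_D (pCons c p)) =
      at_D (smult c [:of_int k * b', 1:] + (pCons 0 ?q - smult (of_int k) ?q))"
    unfolding at_D_pCons[of c p] E.add E.scale comm pCons.IH w0
    by (simp only: at_D_add at_D_smult at_D.diff at_D_shift)
  also have "smult c [:of_int k * b', 1:] + (pCons 0 ?q - smult (of_int k) ?q) =
      [:of_int k * b', 1:] * (pCons c p \<circ>\<^sub>p [:- of_int k, 1:])"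
    by (simp add: pcompose_pCons algebra_simps smult_add_right smult_diff_right)
  finally show ?case .
qed

section \<open>The twisted loop module in polynomial coordinates\<close>

definition loop_poly :: "complex \<Rightarrow> int \<Rightarrow> int \<Rightarrow> complex poly \<Rightarrow> complex poly" where
  "loop_poly a k j p =
     smult ((-1) powi k) ([:of_int k * b', 1:] * (p \<circ>\<^sub>p [:- of_int k, 1:])) +
     [:a + of_int k * (b' + 1) + of_int j, -1:] * p"

lemma loop_d_op_at_D:
  "loop_d_op scale act (-1) a (b' + 1) k j (at_D p) = at_D (loop_poly a k j p)"
proof -
  have "loop_d_op scale act (-1) a (b' + 1) k j (at_D p) =
      at_D (smult ((-1) powi k) ([:of_int k * b', 1:] * (p \<circ>\<^sub>p [:- of_int k, 1:])) - pCons 0 p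
        + smult (a + of_int k * (b' + 1) + of_int j) p)"
    unfolding loop_d_op_def der_d_minus_one exp_act_at_D
    by (simp only: at_D_add at_D_smult at_D.diff at_D_shift)
  also have "smult ((-1) powi k) ([:of_int k * b', 1:] * (p \<circ>\<^sub>p [:- of_int k, 1:])) - pCons 0 p
        + smult (a + of_int k * (b' + 1) + of_int j) p = loop_poly a k j p"
    by (simp add: loop_poly_def)
  finally show ?thesis .
qed

definition reflect :: "complex \<Rightarrow> int \<Rightarrow> complex poly \<Rightarrow> complex poly" where
  "reflect a j p = smult ((-1) powi j) (p \<circ>\<^sub>p [:a + of_int j, -1:])"

text \<open>The substitution \<open>x \<mapsto> a + k + j - x\<close> sends \<open>x + k b'\<close> to \<open>a + k (b' + 1) + j - x\<close>. It therefore
  exchanges the linear factors of the two summands of \<^const>\<open>loop_poly\<close>, as well as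
  the shifted and the unshifted argument of \<open>p\<close>; the signs \<open>(-1)\<^sup>k\<close> and \<open>(-1)\<^sup>j\<close> account for
  the factor \<open>(-1)\<^sup>k\<close> carried by only one of the summands.\<close>

lemma reflect_loop_poly:
  "reflect a (k + j) (loop_poly a k j p) = loop_poly a k j (reflect a j p)"
  by (rule poly_eq_poly_eq_iff[THEN iffD1], cases "even k"; cases "even j")
    (simp_all add: fun_eq_iff reflect_def loop_poly_def poly_pcompose power_int_minus_left
      algebra_simps)

lemma reflect_1: "reflect a j 1 = [:(-1) powi j:]"
  by (simp add: reflect_def one_pCons)

text \<open>For odd \<open>k\<close> the two summands of \<^const>\<open>loop_poly\<close> have the same leading term \<open>- c x\<^sup>n\<^sup>+\<^sup>1\<close>, where
  \<open>c x\<^sup>n\<close> is the leading term of \<open>p\<close>; for even \<open>k\<close> these terms would cancel.\<close>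

lemma degree_loop_poly_1:
  assumes "p \<noteq> 0"
  shows "degree (loop_poly a 1 j p) = Suc (degree p)"
proof -
  let ?q = "p \<circ>\<^sub>p [:- 1, 1:]"
  have q: "degree ?q = degree p" "coeff ?q (degree p) = lead_coeff p"
    using lead_coeff_comp[of "[:- 1, 1:]" p] by (simp_all add: degree_pcompose)
  have P: "loop_poly a 1 j p =
      smult (a + 1 + of_int j + b') p - pCons 0 p - (smult b' ?q + pCons 0 ?q)"
    by (simp add: loop_poly_def algebra_simps)
  have "coeff (loop_poly a 1 j p) (Suc (degree p)) = - 2 * lead_coeff p"
    using q by (simp add: P coeff_eq_0)
  moreover have "degree (loop_poly a 1 j p) \<le> Suc (degree p)"
    by (rule degree_le) (use q in \<open>auto simp: P coeff_eq_0 coeff_pCons split: nat.split\<close>)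
  ultimately show ?thesis
    using assms by (intro antisym le_degree) auto
qed

end

section \<open>The swap involution\<close>

locale highest_weight_O_nonzero = highest_weight_O scale act w0 b'
  for scale :: "complex \<Rightarrow> 'w::ab_group_add \<Rightarrow> 'w" and act and w0 and b' +
  fixes a :: complex
  assumes nonzero: "b' \<noteq> 0"
begin

abbreviation vact :: "virasoro \<Rightarrow> (int \<Rightarrow>\<^sub>0 'w) \<Rightarrow> (int \<Rightarrow>\<^sub>0 'w)" where
  "vact \<equiv> loop_act scale act (-1) a (b' + 1)"

sublocale TW: vector_space "pm_scale scale :: complex \<Rightarrow> (int \<Rightarrow>\<^sub>0 'w) \<Rightarrow> _"
  by (intro vector_space_pm_scale W.V.vector_space_axioms)

sublocale LR: Vector_Spaces.linear "pm_scale scale" "pm_scale scale" "vact x" for x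
  by (rule linear_loop_act_right[OF O])

sublocale LL: Vector_Spaces.linear vir_scale "pm_scale scale" "\<lambda>x. vact x v" for v
  by (rule linear_loop_act_left[OF O])

definition coord :: "'w \<Rightarrow> complex poly" where
  "coord = inv at_D"

lemma coord_at_D [simp]: "coord (at_D p) = p"
  by (simp add: coord_def inj_at_D nonzero)

lemma at_D_cases: obtains p where "w = at_D p"
  using surj_at_D by blast

definition swap :: "(int \<Rightarrow>\<^sub>0 'w) \<Rightarrow> (int \<Rightarrow>\<^sub>0 'w)" where
  "swap = pm_ext (\<lambda>j w. tensor_t (at_D (reflect a j (coord w))) j)"

lemma linear_swap: "Vector_Spaces.linear (pm_scale scale) (pm_scale scale) swap"
  unfolding swap_def
proof (intro linear_pm_ext W.V.vector_space_axioms TW.vector_space_axioms)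
  fix j
  show "Vector_Spaces.linear scale (pm_scale scale)
      (\<lambda>w. tensor_t (at_D (reflect a j (coord w))) j)"
    unfolding Vector_Spaces.linear_iff
  proof (intro conjI allI W.V.vector_space_axioms TW.vector_space_axioms)
    fix x y c
    obtain p q where [simp]: "x = at_D p" "y = at_D q"
      using at_D_cases by metis
    show "tensor_t (at_D (reflect a j (coord (x + y)))) j =
        tensor_t (at_D (reflect a j (coord x))) j + tensor_t (at_D (reflect a j (coord y))) j"
      by (simp flip: at_D_add single_add)
         (simp add: reflect_def pcompose_add smult_add_right)
    show "tensor_t (at_D (reflect a j (coord (scale c x)))) j =
        pm_scale scale c (tensor_t (at_D (reflect a j (coord x))) j)"
      by (simp add: pm_scale_single[OF W.V.vector_space_axioms] flip: at_D_smult)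
         (simp add: reflect_def pcompose_smult mult.commute)
  qed
qed

sublocale swap: Vector_Spaces.linear "pm_scale scale" "pm_scale scale" swap
  by (rule linear_swap)

lemma swap_tensor_at_D: "swap (tensor_t (at_D p) j) = tensor_t (at_D (reflect a j p)) j"
  using coord_at_D[of 0] by (simp add: swap_def pm_ext_single reflect_def)

lemma vact_tensor_at_D:
  "vact (vir_d k) (tensor_t (at_D p) j) = tensor_t (at_D (loop_poly a k j p)) (k + j)"
  by (simp add: loop_act_d_tensor_t[OF O] loop_d_op_at_D)

lemma swap_vact_d: "swap (vact (vir_d k) v) = vact (vir_d k) (swap v)"
proof (rule additive_eqI[of "\<lambda>v. swap (vact (vir_d k) v)"])
  fix j w
  obtain p where "w = at_D p"
    by (rule at_D_cases)
  then show "swap (vact (vir_d k) (tensor_t w j)) = vact (vir_d k) (swap (tensor_t w j))"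
    by (simp add: vact_tensor_at_D swap_tensor_at_D reflect_loop_poly)
qed (simp_all add: LR.add swap.add)

lemma swap_vact: "swap (vact x v) = vact x (swap v)"
proof (rule additive_eqI[of "\<lambda>x. swap (vact x v)"])
  fix q c
  show "swap (vact (Poly_Mapping.single q c) v) = vact (Poly_Mapping.single q c) (swap v)"
  proof (cases q)
    case (Vd k)
    have "Poly_Mapping.single (Vd k) c = vir_scale c (vir_d k)"
      by (simp add: vir_scale_single)
    then show ?thesis
      by (simp only: Vd LL.scale swap.scale swap_vact_d)
  next
    case Vz
    then show ?thesis
      by (simp add: loop_act_single_Vz[OF O] swap.zero)
  qed
qed (simp_all add: LL.add swap.add)

lemma swap_orbit:
  "swap ((vact (vir_d 1) ^^ i) (tensor_t w0 j)) =
     pm_scale scale ((-1) powi j) ((vact (vir_d 1) ^^ i) (tensor_t w0 j))"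
proof (induction i)
  case 0
  have "at_D (reflect a j 1) = scale ((-1) powi j) w0"
    by (simp add: reflect_1 at_D_pCons AR.zero)
  then show ?case
    using swap_tensor_at_D[where p = 1] by (simp add: pm_scale_single[OF W.V.vector_space_axioms])
qed (simp add: swap_vact LR.scale)

abbreviation "L0 \<equiv> loop_L0 scale act w0 a b'"
abbreviation "L1 \<equiv> loop_L1 scale act w0 a b'"

lemma subspace_L0: "TW.subspace L0" and subspace_L1: "TW.subspace L1"
  by (simp_all add: loop_L0_def loop_L1_def)

lemma swap_L0:
  assumes "v \<in> L0"
  shows "swap v = v"
proof -
  have "TW.subspace {v. swap v = v}"
    by (simp add: TW.subspace_def swap.zero swap.add swap.scale)
  moreover have "{(vact (vir_d 1) ^^ i) (tensor_t w0 (2 * j)) | (i::nat) (j::int). True} \<subseteq> {v. swap v = v}"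
    by (auto simp: swap_orbit power_int_minus_left)
  ultimately show ?thesis
    using assms TW.span_minimal unfolding loop_L0_def by blast
qed

lemma swap_L1:
  assumes "v \<in> L1"
  shows "swap v = - v"
proof -
  have "TW.subspace {v. swap v = - v}"
    by (simp add: TW.subspace_def swap.zero swap.add swap.scale)
  moreover have "{(vact (vir_d 1) ^^ i) (tensor_t w0 (2 * j + 1)) | (i::nat) (j::int). True} \<subseteq> {v. swap v = - v}"
    by (auto simp: swap_orbit power_int_minus_left)
  ultimately show ?thesis
    using assms TW.span_minimal unfolding loop_L1_def by blast
qed

section \<open>The decomposition\<close>

lemma orbit_degree:
  "\<exists>q. (vact (vir_d 1) ^^ n) (tensor_t w0 j) = tensor_t (at_D q) (j + int n) \<and>
     degree q = n \<and> q \<noteq> 0"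
proof (induction n)
  case 0
  show ?case
    by (rule exI[of _ 1]) simp
next
  case (Suc n)
  then obtain q where q: "(vact (vir_d 1) ^^ n) (tensor_t w0 j) = tensor_t (at_D q) (j + int n)"
    "degree q = n" "q \<noteq> 0"
    by blast
  show ?case
    by (rule exI[of _ "loop_poly a 1 (j + int n) q"])
      (use q degree_loop_poly_1[OF q(3), of a "j + int n"]
        vact_tensor_at_D[where k = 1 and p = q and j = "j + int n"] in \<open>auto simp: add_ac\<close>)
qed

definition L_sum :: "(int \<Rightarrow>\<^sub>0 'w) set" where
  "L_sum = {x + y | x y. x \<in> L0 \<and> y \<in> L1}"

lemma subspace_L_sum: "TW.subspace L_sum"
  unfolding L_sum_def by (intro TW.subspace_sums subspace_L0 subspace_L1)

lemma orbit_in_L_sum: "(vact (vir_d 1) ^^ n) (tensor_t w0 j) \<in> L_sum"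
proof (cases "even j")
  case True
  then have "(vact (vir_d 1) ^^ n) (tensor_t w0 j) \<in> L0"
    unfolding loop_L0_def by (intro TW.span_base) (auto elim!: evenE)
  then show ?thesis
    unfolding L_sum_def using TW.subspace_0[OF subspace_L1] by force
next
  case False
  then have "(vact (vir_d 1) ^^ n) (tensor_t w0 j) \<in> L1"
    unfolding loop_L1_def by (intro TW.span_base) (auto elim!: oddE)
  then show ?thesis
    unfolding L_sum_def using TW.subspace_0[OF subspace_L0] by force
qed

text \<open>Gaussian elimination on the degree: a multiple of \<open>d\<^sub>1\<^sup>n (w\<^sub>0 \<otimes> t\<^sup>m\<^sup>-\<^sup>n)\<close> removes the term of
  degree \<open>n\<close>.\<close>

lemma tensor_in_L_sum: "(\<And>i. i \<ge> n \<Longrightarrow> coeff p i = 0) \<Longrightarrow> tensor_t (at_D p) m \<in> L_sum"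
proof (induction n arbitrary: p)
  case 0
  then have "p = 0"
    by (simp add: poly_eq_iff)
  then show ?case
    using TW.subspace_0[OF subspace_L_sum] by simp
next
  case (Suc n)
  obtain q where q: "(vact (vir_d 1) ^^ n) (tensor_t w0 (m - int n)) = tensor_t (at_D q) m"
    "degree q = n" "q \<noteq> 0"
    using orbit_degree[of n "m - int n"] by auto
  define c where "c = coeff p n / lead_coeff q"
  define r where "r = p - smult c q"
  have "coeff r i = 0" if "i \<ge> n" for i
    using that q(2,3) Suc.prems[of i] by (cases "i = n") (auto simp: r_def c_def coeff_eq_0)
  then have "tensor_t (at_D r) m \<in> L_sum"
    by (rule Suc.IH)
  moreover have "tensor_t (at_D q) m \<in> L_sum"
    using orbit_in_L_sum[of n "m - int n"] q(1) by simp
  moreover have "tensor_t (at_D p) m = tensor_t (at_D r) m + pm_scale scale c (tensor_t (at_D q) m)"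
    by (simp add: r_def pm_scale_single[OF W.V.vector_space_axioms] flip: at_D_smult single_add at_D_add)
  ultimately show ?case
    by (simp add: TW.subspace_add TW.subspace_scale subspace_L_sum)
qed

lemma L_sum_UNIV: "L_sum = UNIV"
proof -
  have "v \<in> L_sum" for v
  proof (induction v rule: update_induct)
    case const
    show ?case
      by (rule TW.subspace_0[OF subspace_L_sum])
  next
    case (update v j w)
    then have "Poly_Mapping.update j w v = v + tensor_t w j"
      by (intro poly_mapping_eqI)
        (auto simp: lookup_add lookup_update lookup_single in_keys_iff when_def)
    moreover obtain p where "w = at_D p"
      by (rule at_D_cases)
    then have "tensor_t w j \<in> L_sum"
      using tensor_in_L_sum[of "Suc (degree p)" p j] by (simp add: coeff_eq_0)
    ultimately show ?case
      using update by (simp add: TW.subspace_add subspace_L_sum)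
  qed
  then show ?thesis by blast
qed

lemma no_two_torsion: "v = - v \<Longrightarrow> v = 0" for v :: "int \<Rightarrow>\<^sub>0 'w"
proof -
  assume "v = - v"
  then have "v + v = 0"
    by (metis add.right_inverse)
  then have "pm_scale scale 2 v = 0"
    using TW.scale_left_distrib[of 1 1 v] by simp
  then show "v = 0"
    by simp
qed

text \<open>Both inclusions into the eigenspaces are known. As the two spaces together span the module and
  distinct eigenspaces are independent, the inclusions are equalities.\<close>

lemma L0_eq: "L0 = {v. swap v = v}" and L1_eq: "L1 = {v. swap v = - v}"
proof -
  have ex: "\<exists>x y. v = x + y \<and> x \<in> L0 \<and> y \<in> L1 \<and> swap v = x - y" for v
    using L_sum_UNIV swap_L0 swap_L1 swap.add unfolding L_sum_def
    by (smt (verit) UNIV_I ab_group_add_class.ab_diff_conv_add_uminus mem_Collect_eq)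
  show "L0 = {v. swap v = v}"
  proof (intro equalityI subsetI CollectI)
    fix v assume "v \<in> {v. swap v = v}"
    then obtain x y where "v = x + y" "x \<in> L0" "x + y = x - y"
      using ex[of v] by auto
    then show "v \<in> L0"
      using no_two_torsion[of y] by simp
  qed (rule swap_L0)
  show "L1 = {v. swap v = - v}"
  proof (intro equalityI subsetI CollectI)
    fix v assume "v \<in> {v. swap v = - v}"
    then obtain x y where "v = x + y" "y \<in> L1" "x - y = - (x + y)"
      using ex[of v] by auto
    then show "v \<in> L1"
      using no_two_torsion[of x] by (simp add: algebra_simps)
  qed (rule swap_L1)
qed

lemma lie_submodule_L0: "lie_submodule vir_scale vir_bracket (pm_scale scale) vact L0"
  unfolding lie_submodule_def
  using lie_module_loop_act[OF O] subspace_L0 by (auto simp: L0_eq swap_vact)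

lemma lie_submodule_L1: "lie_submodule vir_scale vir_bracket (pm_scale scale) vact L1"
  unfolding lie_submodule_def
  using lie_module_loop_act[OF O] subspace_L1 by (auto simp: L1_eq swap_vact LR.neg)

lemma direct_sum_L0_L1: "is_internal_direct_sum L0 L1"
proof -
  have "v = 0" if "v \<in> L0" "v \<in> L1" for v
    using swap_L0[OF that(1)] swap_L1[OF that(2)] no_two_torsion by simp
  then have "L0 \<inter> L1 = {0}"
    using TW.subspace_0[OF subspace_L0] TW.subspace_0[OF subspace_L1] by blast
  then show ?thesis
    using L_sum_UNIV by (simp add: is_internal_direct_sum_def L_sum_def)
qed

end

theorem lemma9:
  fixes scale :: "complex \<Rightarrow> 'w::ab_group_add \<Rightarrow> 'w"
    and act :: "complex poly \<Rightarrow> 'w \<Rightarrow> 'w"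
    and w\<^sub>0 :: 'w and a b' :: complex
  assumes "cat_O scale act"
    and "highest_weight_module scale act w\<^sub>0 b'"
    and "b' \<noteq> 0"
  shows "lie_submodule vir_scale vir_bracket (pm_scale scale) (loop_act scale act (-1) a (b' + 1))
           (loop_L0 scale act w\<^sub>0 a b') \<and>
         lie_submodule vir_scale vir_bracket (pm_scale scale) (loop_act scale act (-1) a (b' + 1))
           (loop_L1 scale act w\<^sub>0 a b') \<and>
         is_internal_direct_sum (loop_L0 scale act w\<^sub>0 a b') (loop_L1 scale act w\<^sub>0 a b')"
proof -
  interpret highest_weight_O_nonzero scale act w\<^sub>0 b' a
    using assms by unfold_locales
  show ?thesis
    by (intro conjI lie_submodule_L0 lie_submodule_L1 direct_sum_L0_L1)
qed

end
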